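(* Let $B$ be a Hermitian $n\times n$ matrix with $r$ positive eigenvalues. Let $L$ be the Loewner matrix of the function $f(x)=|x|$ at $B$, and let $\phi=(1+\sqrt5)/2$ be the Golden Ratio. Then, for $1\le r<n$, $$\|S_L\| \le 3+2\phi^{-1}\min(r,n-r).$$ If $r$ is $0$ or $n$, then $\|S_L\|$ is $1$.
   Context: Eigenvalues are counted with multiplicity. The Loewner matrix of $f$ at a Hermitian matrix $B$ with eigenvalues $b_1,\dots,b_n$ is the $n\times n$ matrix $L$ with $L_{ij}=\frac{f(b_i)-f(b_j)}{b_i-b_j}$ if $b_i\ne b_j$ and $L_{ij}=f'(b_i)$ if $b_i=b_j$; for $f(x)=|x|$, $f'(b_j)$ is taken to be $1$ at the $r$ positive eigenvalues and $-1$ at the remaining $n-r$ eigenvalues. $S_L$ is the Schur multiplier $A\mapsto L\circ A$ on complex $n\times n$ matrices, where $(L\circ A)_{ij}=L_{ij}A_{ij}$. $\|S_L\|=\sup_{A\neq 0}\|L\circ A\|/\|A\|$, where $\|\cdot\|$ is the operator (spectral) norm on matrices. *)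

theory Defs
  imports
    "HOL-Analysis.Analysis"
    "HOL-Computational_Algebra.Computational_Algebra"
begin

definition hermitian :: "complex^'n^'n \<Rightarrow> bool" where
  "hermitian B \<longleftrightarrow> (\<chi> i j. cnj (B $ j $ i)) = B"

text \<open>The determinant of \<open>X I - B\<close>, computed over the ring of polynomials.\<close>

definition charpoly :: "complex^'n^'n \<Rightarrow> complex poly" where
  "charpoly B = det (\<chi> i j. (if i = j then [:0, 1:] else 0) - [:B $ i $ j:])"

text \<open>
  The family \<open>b\<close> lists the eigenvalues of \<open>B\<close> with (algebraic) multiplicity, in an
  arbitrary order, using the index type of \<open>B\<close> in place of \<open>1, \<dots>, n\<close>.  Such a real
  family exists for every Hermitian matrix, see \<open>hermitian_eigenvalue_list\<close> below.
\<close>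

definition eigenvalue_list :: "complex^'n^'n \<Rightarrow> ('n::finite \<Rightarrow> real) \<Rightarrow> bool" where
  "eigenvalue_list B b \<longleftrightarrow>
     image_mset (\<lambda>i. complex_of_real (b i)) (mset_set UNIV) = proots (charpoly B)"

text \<open>
  The function \<open>f'\<close> gives the diagonal values; it is a parameter because \<open>f\<close> need not be
  differentiable at every eigenvalue.
\<close>

definition loewner_matrix ::
  "(real \<Rightarrow> real) \<Rightarrow> (real \<Rightarrow> real) \<Rightarrow> ('n \<Rightarrow> real) \<Rightarrow> complex^'n^'n" where
  "loewner_matrix f f' b =
     (\<chi> i j. complex_of_real
        (if b i \<noteq> b j then (f (b i) - f (b j)) / (b i - b j) else f' (b i)))"

text \<open>The derivative of the absolute value, with the convention \<open>-1\<close> at \<open>0\<close>.\<close>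

definition abs_deriv :: "real \<Rightarrow> real" where
  "abs_deriv x = (if x > 0 then 1 else -1)"

definition schur_product :: "complex^'n^'n \<Rightarrow> complex^'n^'n \<Rightarrow> complex^'n^'n" where
  "schur_product L A = (\<chi> i j. L $ i $ j * A $ i $ j)"

text \<open>
  The norm of the type \<open>complex^'n^'n\<close> is the Frobenius norm, so the spectral norm is
  taken to be the operator norm of the induced map on \<open>complex^'n\<close>.
\<close>

definition spectral_norm :: "complex^'n^'n \<Rightarrow> real" where
  "spectral_norm A = onorm ((*v) A)"

definition schur_multiplier_norm :: "complex^'n^'n \<Rightarrow> real" where
  "schur_multiplier_norm L =
     (SUP A \<in> {A. A \<noteq> 0}. spectral_norm (schur_product L A) / spectral_norm A)"

definition golden_ratio :: real where
  "golden_ratio = (1 + sqrt 5) / 2"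

lemma poly_charpoly: "poly (charpoly B) z = det (mat z - B)"
  unfolding charpoly_def det_def poly_sum
  by (rule sum.cong)
     (auto simp: poly_prod mat_def of_int_poly intro!: prod.cong)

lemma degree_charpoly: "degree (charpoly (B :: complex^'n^'n)) = CARD('n)"
proof -
  define M :: "complex poly^'n^'n" where
    "M = (\<chi> i j. (if i = j then [:0, 1:] else 0) - [:B $ i $ j:])"
  define t where
    "t p = of_int (sign p) * (\<Prod>i\<in>UNIV. M $ i $ p i)" for p :: "'n \<Rightarrow> 'n"
  have off: "degree (t p) < CARD('n)" if "p permutes UNIV" "p \<noteq> id" for p
  proof -
    obtain k where k: "p k \<noteq> k"
      using \<open>p \<noteq> id\<close> by (auto simp: fun_eq_iff)
    have "degree (t p) \<le> degree (\<Prod>i\<in>UNIV. M $ i $ p i)"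
      by (auto simp: t_def sign_def)
    also have "\<dots> \<le> (\<Sum>i\<in>UNIV. degree (M $ i $ p i))"
      using degree_prod_sum_le[of UNIV "\<lambda>i. M $ i $ p i"] by (simp add: o_def)
    also have "\<dots> < (\<Sum>i\<in>(UNIV :: 'n set). 1)"
      by (rule sum_strict_mono_ex1) (auto simp: M_def intro!: exI[of _ k] k k[symmetric])
    finally show ?thesis by simp
  qed
  have diag: "t id = (\<Prod>i\<in>UNIV. [:- (B $ i $ i), 1:])"
    by (simp add: t_def M_def sign_id)
  have deg_id: "degree (t id) = CARD('n)"
    unfolding diag by (subst degree_prod_eq_sum_degree) auto
  have split: "charpoly B = t id + (\<Sum>p\<in>{p. p permutes UNIV} - {id}. t p)"
    unfolding charpoly_def det_def M_def[symmetric] t_def[symmetric]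
    by (rule sum.remove) (auto simp: permutes_id finite_permutations)
  have "degree (\<Sum>p\<in>{p. p permutes UNIV} - {id}. t p) < CARD('n)"
    by (rule degree_sum_less) (auto intro: off)
  then show ?thesis
    unfolding split by (subst degree_add_eq_left) (simp_all add: deg_id)
qed

lemma hermitian_charpoly_root_real:
  fixes B :: "complex^'n^'n"
  assumes "hermitian B" and "poly (charpoly B) z = 0"
  shows "z \<in> \<real>"
proof -
  have "\<not> invertible (mat z - B)"
    using assms(2) by (simp add: poly_charpoly invertible_det_nz)
  then obtain v where v: "(mat z - B) *v v = 0" "v \<noteq> 0"
    by (metis invertible_left_inverse matrix_left_invertible_ker)
  have ev: "(\<Sum>j\<in>UNIV. B $ i $ j * v $ j) = z * v $ i" for i
  proof -
    have "0 = ((mat z - B) *v v) $ i" using v by simp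
    also have "\<dots> = (\<Sum>j\<in>UNIV. (if i = j then z * v $ j else 0) - B $ i $ j * v $ j)"
      unfolding matrix_vector_mult_def by (auto simp: mat_def algebra_simps intro!: sum.cong)
    also have "\<dots> = z * v $ i - (\<Sum>j\<in>UNIV. B $ i $ j * v $ j)"
      by (simp add: sum_subtractf)
    finally show ?thesis by simp
  qed
  have herm: "cnj (B $ i $ j) = B $ j $ i" for i j
    using assms(1) unfolding hermitian_def vec_eq_iff by (metis vec_lambda_beta)
  define q where "q = (\<Sum>i\<in>UNIV. \<Sum>j\<in>UNIV. cnj (v $ i) * B $ i $ j * v $ j)"
  define s where "s = (\<Sum>i\<in>UNIV. cnj (v $ i) * v $ i)"
  have "cnj q = (\<Sum>i\<in>UNIV. \<Sum>j\<in>UNIV. cnj (v $ j) * B $ j $ i * v $ i)"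
    by (simp add: q_def herm mult_ac)
  also have "\<dots> = q"
    unfolding q_def by (rule sum.swap)
  finally have q: "cnj q = q" .
  have "q = (\<Sum>i\<in>UNIV. cnj (v $ i) * (\<Sum>j\<in>UNIV. B $ i $ j * v $ j))"
    by (simp add: q_def sum_distrib_left mult.assoc)
  also have "\<dots> = z * s"
    unfolding ev by (simp add: s_def sum_distrib_left mult_ac)
  finally have qz: "q = z * s" .
  have s: "s = of_real (\<Sum>i\<in>UNIV. (cmod (v $ i))\<^sup>2)"
    by (simp add: s_def complex_norm_square mult.commute del: of_real_power)
  obtain k where "v $ k \<noteq> 0" using v(2) by (auto simp: vec_eq_iff)
  then have "(\<Sum>i\<in>UNIV. (cmod (v $ i))\<^sup>2) > 0"
    by (intro sum_pos2[of _ k]) auto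
  then have "s \<noteq> 0" "cnj s = s"
    unfolding s by (simp_all only: of_real_eq_0_iff complex_cnj_complex_of_real less_imp_neq[symmetric])
      auto
  with q qz have "cnj z = z" by simp
  then show ?thesis by (simp add: Reals_cnj_iff)
qed

lemma hermitian_eigenvalue_list:
  fixes B :: "complex^'n^'n"
  assumes "hermitian B"
  shows "\<exists>b. eigenvalue_list B b"
proof -
  obtain xs where xs: "mset xs = proots (charpoly B)"
    using ex_mset by blast
  then have len: "length xs = CARD('n)"
    by (metis size_mset size_proots_complex degree_charpoly)
  have "charpoly B \<noteq> 0"
    using degree_charpoly[of B] by force
  then have real: "x \<in> \<real>" if "x \<in> set xs" for x
    using that hermitian_charpoly_root_real[OF assms, of x]
    by (metis mem_Collect_eq set_count_proots set_mset_mset xs)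
  obtain h :: "'n \<Rightarrow> nat" where h: "bij_betw h UNIV {..<CARD('n)}"
    by (metis ex_bij_betw_finite_nat finite_class.finite_UNIV lessThan_atLeast0)
  have "image_mset (\<lambda>i. complex_of_real (Re (xs ! h i))) (mset_set UNIV)
      = image_mset (\<lambda>i. xs ! h i) (mset_set UNIV)"
    using h len by (intro image_mset_cong) (auto simp: bij_betw_def intro!: of_real_Re real nth_mem)
  also have "\<dots> = image_mset ((!) xs) (image_mset h (mset_set UNIV))"
    by (simp add: image_mset.compositionality o_def)
  also have "image_mset h (mset_set UNIV) = mset_set {..<length xs}"
    using h len by (simp add: bij_betw_def image_mset_mset_set)
  also have "image_mset ((!) xs) \<dots> = mset xs"
    by (metis lessThan_atLeast0 map_nth mset_map mset_upt)
  finally show ?thesis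
    unfolding eigenvalue_list_def xs by (rule exI[of _ "\<lambda>i. Re (xs ! h i)"])
qed

end

theory Submission
  imports Defs
begin

text \<open>
  Let \<open>s\<^sub>i\<close> be \<open>1\<close> or \<open>-1\<close> according to whether \<open>b\<^sub>i\<close> is positive, and \<open>\<sigma> = diag(s\<^sub>i)\<close>.  The
  entries of \<open>L\<close> with \<open>s\<^sub>i = s\<^sub>j\<close> equal \<open>(s\<^sub>i + s\<^sub>j)/2\<close>, so on the diagonal blocks \<open>L\<close> acts as
  \<open>A \<mapsto> (\<sigma>A + A\<sigma>)/2\<close>, which is a contraction.  The entries of \<open>L\<close> in the two off-diagonal
  blocks have modulus at most \<open>1\<close>, and these blocks have \<open>k = min(r, n - r)\<close> rows and
  \<open>k\<close> columns, respectively; each has Schur multiplier norm at most \<open>\<surd>k\<close>.  Hence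
  \<open>\<parallel>S\<^sub>L\<parallel> \<le> 1 + 2\<surd>k \<le> 2 + k\<close>, which is stronger than the claim because \<open>2/\<phi> \<ge> 1\<close>.
\<close>

lemma norm_matrix_vector_mult_le:
  fixes A :: "complex^'n^'n"
  shows "norm (A *v x) \<le> spectral_norm A * norm x"
  unfolding spectral_norm_def by (rule onorm) simp

lemma spectral_norm_leI:
  fixes A :: "complex^'n^'n"
  assumes "\<And>x. norm (A *v x) \<le> c * norm x"
  shows "spectral_norm A \<le> c"
  unfolding spectral_norm_def by (rule onorm_le) (rule assms)

lemma spectral_norm_pos:
  fixes A :: "complex^'n^'n"
  assumes "A \<noteq> 0"
  shows "0 < spectral_norm A"
proof -
  have "(*v) A \<noteq> (\<lambda>x. 0)"
    using assms by (metis matrix_eq matrix_vector_mult_0)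
  then show ?thesis
    unfolding spectral_norm_def by (auto simp: onorm_pos_lt fun_eq_iff)
qed

lemma spectral_norm_minus:
  fixes A :: "complex^'n^'n"
  shows "spectral_norm (- A) = spectral_norm A"
proof -
  have "(*v) (- A) = (\<lambda>x. - (A *v x))"
    by (simp add: fun_eq_iff vec_eq_iff matrix_vector_mult_def sum_negf)
  then show ?thesis
    unfolding spectral_norm_def by (simp add: onorm_neg)
qed

lemma norm_vec_scale_le:
  fixes x :: "complex^'n"
  assumes "\<And>j. cmod (c j) \<le> 1"
  shows "norm (\<chi> j. c j * x $ j) \<le> norm x"
  unfolding norm_vec_def
  by (rule L2_set_mono) (auto simp: norm_mult intro: mult_left_le_one_le assms)

lemma norm_axis_eq:
  fixes a :: "'a::real_normed_vector"
  shows "norm (axis j a :: 'a^'n) = norm a"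
proof -
  have "norm (axis j a :: 'a^'n) = sqrt (\<Sum>i\<in>UNIV. if i = j then (norm a)\<^sup>2 else 0)"
    unfolding norm_vec_def L2_set_def
    by (intro arg_cong[of _ _ sqrt] sum.cong) (auto simp: axis_def)
  then show ?thesis by simp
qed

text \<open>Multiplying row \<open>i\<close> of \<open>A\<close> by row \<open>i\<close> of
  \<open>M\<close> amounts to rescaling the entries of \<open>x\<close> before applying
  \<open>A\<close>, so each coordinate in \<open>S\<close> has modulus at most
  \<open>spectral_norm A * norm x\<close>. The other coordinates vanish, and the Euclidean norm
  contributes \<open>sqrt (card S)\<close>.\<close>

lemma norm_schur_product_rows_le:
  fixes A M :: "complex^'n^'n"
  assumes le: "\<And>i j. cmod (M $ i $ j) \<le> 1"
    and zero: "\<And>i j. i \<notin> S \<Longrightarrow> M $ i $ j = 0"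
  shows "norm (schur_product M A *v x) \<le> sqrt (card S) * (spectral_norm A * norm x)"
proof -
  let ?y = "schur_product M A *v x"
  let ?c = "spectral_norm A * norm x"
  have c: "0 \<le> ?c"
    by (rule order_trans[OF _ norm_matrix_vector_mult_le]) simp
  have comp: "norm (?y $ i) \<le> (if i \<in> S then ?c else 0)" for i
  proof (cases "i \<in> S")
    case True
    let ?x = "\<chi> j. M $ i $ j * x $ j"
    have "?y $ i = (A *v ?x) $ i"
      by (simp add: schur_product_def matrix_vector_mult_def mult_ac)
    then have "norm (?y $ i) \<le> norm (A *v ?x)"
      by (metis Finite_Cartesian_Product.norm_nth_le)
    also have "\<dots> \<le> spectral_norm A * norm ?x"
      by (rule norm_matrix_vector_mult_le)
    also have "\<dots> \<le> ?c"
      using le by (intro mult_left_mono norm_vec_scale_le)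
        (auto simp: spectral_norm_def intro!: onorm_pos_le)
    finally show ?thesis using True by simp
  next
    case False
    then show ?thesis
      by (simp add: schur_product_def matrix_vector_mult_def zero)
  qed
  have "norm ?y \<le> L2_set (\<lambda>i. if i \<in> S then ?c else 0) UNIV"
    unfolding norm_vec_def[of ?y] by (rule L2_set_mono[OF comp]) simp
  also have "\<dots> = sqrt (\<Sum>i\<in>UNIV. if i \<in> S then ?c\<^sup>2 else 0)"
    unfolding L2_set_def by (intro arg_cong[of _ _ sqrt] sum.cong) auto
  also have "\<dots> = sqrt (card S) * ?c"
    using c by (simp add: sum.If_cases real_sqrt_mult)
  finally show ?thesis .
qed

text \<open>Here the image is a sum over \<open>j\<close> in \<open>S\<close> of
  \<open>x $ j\<close> times column \<open>j\<close> of \<open>A\<close>, with entries shrunk by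
  column \<open>j\<close> of \<open>M\<close>. Each summand has norm at most
  \<open>spectral_norm A * norm (x $ j)\<close>.\<close>

lemma norm_schur_product_columns_le:
  fixes A M :: "complex^'n^'n"
  assumes le: "\<And>i j. cmod (M $ i $ j) \<le> 1"
    and zero: "\<And>i j. j \<notin> S \<Longrightarrow> M $ i $ j = 0"
  shows "norm (schur_product M A *v x) \<le> sqrt (card S) * (spectral_norm A * norm x)"
proof -
  let ?v = "\<lambda>j. (\<chi> i. M $ i $ j * (A *v axis j (x $ j)) $ i)"
  have v: "(A *v axis j (x $ j)) $ i = A $ i $ j * x $ j" for i j
    by (simp add: matrix_vector_mult_def axis_def if_distrib[of "\<lambda>z. _ * z"] cong: if_cong)
  have s: "0 \<le> spectral_norm A"
    unfolding spectral_norm_def by (intro onorm_pos_le) simp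
  have "schur_product M A *v x = (\<Sum>j\<in>S. ?v j)"
    by (simp add: vec_eq_iff v)
      (auto simp: schur_product_def matrix_vector_mult_def mult_ac zero
        intro!: sum.mono_neutral_right)
  then have "norm (schur_product M A *v x) \<le> (\<Sum>j\<in>S. norm (?v j))"
    by (simp only: norm_sum)
  also have "\<dots> \<le> (\<Sum>j\<in>S. spectral_norm A * norm (x $ j))"
  proof (rule sum_mono)
    fix j
    have "norm (?v j) \<le> norm (A *v axis j (x $ j))"
      by (rule norm_vec_scale_le) (rule le)
    also have "\<dots> \<le> spectral_norm A * norm (axis j (x $ j))"
      by (rule norm_matrix_vector_mult_le)
    finally show "norm (?v j) \<le> spectral_norm A * norm (x $ j)"
      by (simp add: norm_axis_eq)
  qed
  \<comment> \<open>Cauchy-Schwarz against the constant vector 1 on \<open>S\<close> yields the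
    factor \<open>sqrt (card S)\<close>.\<close>
  also have "\<dots> = spectral_norm A * (\<Sum>j\<in>S. \<bar>1\<bar> * \<bar>norm (x $ j)\<bar>)"
    by (simp add: sum_distrib_left)
  also have "\<dots> \<le> spectral_norm A * (L2_set (\<lambda>_. 1) S * L2_set (\<lambda>j. norm (x $ j)) S)"
    by (rule mult_left_mono[OF L2_set_mult_ineq s])
  also have "\<dots> \<le> spectral_norm A * (sqrt (card S) * norm x)"
  proof (intro mult_left_mono mult_mono s)
    show "L2_set (\<lambda>j. norm (x $ j)) S \<le> norm x"
      unfolding norm_vec_def L2_set_def by (intro real_sqrt_le_mono sum_mono2) auto
  qed (auto simp: L2_set_def intro: sum_nonneg)
  finally show ?thesis by (simp add: mult_ac)
qed

lemma spectral_norm_schur_product_block_sign_le: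
  fixes A L :: "complex^'n^'n"
  assumes le: "\<And>i j. cmod (L $ i $ j) \<le> 1"
    and pos: "\<And>i j. i \<in> P \<Longrightarrow> j \<in> P \<Longrightarrow> L $ i $ j = 1"
    and neg: "\<And>i j. i \<notin> P \<Longrightarrow> j \<notin> P \<Longrightarrow> L $ i $ j = -1"
    and S: "S = P \<or> S = - P"
  shows "spectral_norm (schur_product L A) \<le> (1 + 2 * sqrt (card S)) * spectral_norm A"
proof (rule spectral_norm_leI)
  fix x :: "complex^'n"
  define s :: "'n \<Rightarrow> complex" where "s i = (if i \<in> P then 1 else -1)" for i
  define R where "R = (\<chi> i j. if i \<in> S \<and> j \<notin> S then L $ i $ j else 0)"
  define C where "C = (\<chi> i j. if i \<notin> S \<and> j \<in> S then L $ i $ j else 0)"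
  let ?sx = "\<chi> j. s j * x $ j"
  let ?sAx = "\<chi> i. s i * (A *v x) $ i"
  let ?c = "spectral_norm A * norm x"
  have s1: "cmod (s i) \<le> 1" for i
    by (simp add: s_def)
  \<comment> \<open>The average of the signs vanishes on the off-diagonal blocks. One of these lies
    in the rows \<open>S\<close>, the other in the columns \<open>S\<close>, whichever of
    \<open>P\<close> and \<open>- P\<close> is chosen.\<close>
  have L: "L $ i $ j = (s i + s j) / 2 + R $ i $ j + C $ i $ j" for i j
    using S by (auto simp: s_def R_def C_def pos neg)
  have split: "schur_product L A *v x =
      (1/2) *\<^sub>R (?sAx + A *v ?sx) + schur_product R A *v x + schur_product C A *v x"
    by (simp add: vec_eq_iff schur_product_def matrix_vector_mult_def L sum_distrib_left
        flip: sum.distrib)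
      (simp add: scaleR_conv_of_real sum_distrib_left field_simps flip: sum.distrib)
  have "norm ?sAx \<le> norm (A *v x)"
    by (rule norm_vec_scale_le) (rule s1)
  then have 1: "norm ?sAx \<le> ?c"
    using norm_matrix_vector_mult_le[of A x] by linarith
  have "spectral_norm A * norm ?sx \<le> ?c"
    by (intro mult_left_mono norm_vec_scale_le s1)
      (auto simp: spectral_norm_def intro!: onorm_pos_le)
  then have 2: "norm (A *v ?sx) \<le> ?c"
    using norm_matrix_vector_mult_le[of A ?sx] by linarith
  have D: "norm ((1/2) *\<^sub>R (?sAx + A *v ?sx)) \<le> ?c"
    using 1 2 norm_triangle_ineq[of ?sAx "A *v ?sx"] by simp
  have R: "norm (schur_product R A *v x) \<le> sqrt (card S) * ?c"
    by (rule norm_schur_product_rows_le) (auto simp: R_def le)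
  have C: "norm (schur_product C A *v x) \<le> sqrt (card S) * ?c"
    by (rule norm_schur_product_columns_le) (auto simp: C_def le)
  have "norm (schur_product L A *v x) \<le> ?c + sqrt (card S) * ?c + sqrt (card S) * ?c"
    unfolding split by (intro norm_triangle_mono D R C)
  then show "norm (schur_product L A *v x) \<le> (1 + 2 * sqrt (card S)) * spectral_norm A * norm x"
    by (simp add: algebra_simps)
qed

text \<open>The values of \<open>abs_deriv\<close> agree with the difference quotients inside each
  sign block; its value -1 at 0 puts zero eigenvalues in the block of the negative ones.\<close>

lemma loewner_matrix_abs_nth:
  "loewner_matrix abs abs_deriv b $ i $ j =
     (if b i > 0 \<and> b j > 0 then 1 else if \<not> b i > 0 \<and> \<not> b j > 0 then -1
      else complex_of_real ((\<bar>b i\<bar> - \<bar>b j\<bar>) / (b i - b j)))"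
proof -
  have "(b j - b i) / (b i - b j) = -1" if "b i \<noteq> b j"
    using that by (simp add: divide_simps)
  then show ?thesis
    by (auto simp: loewner_matrix_def abs_deriv_def simp del: of_real_divide)
qed

lemma norm_loewner_matrix_abs_nth_le:
  "cmod (loewner_matrix abs abs_deriv b $ i $ j) \<le> 1"
proof -
  \<comment> \<open>Reverse triangle inequality; for \<open>b i = b j\<close> the quotient is 0, as
    division by 0 yields 0.\<close>
  have "\<bar>(\<bar>b i\<bar> - \<bar>b j\<bar>) / (b i - b j)\<bar> \<le> 1"
    by (simp add: abs_divide divide_le_eq_1 abs_triangle_ineq3)
  then show ?thesis
    by (simp add: loewner_matrix_abs_nth del: of_real_divide)
qed

theorem theorem5:
  fixes B :: "complex^'n^'n" and b :: "'n \<Rightarrow> real" and n r :: nat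
  assumes "hermitian B"
    and "eigenvalue_list B b"
    and "n = CARD('n)"
    and "r = card {i. b i > 0}"
  shows "(1 \<le> r \<and> r < n \<longrightarrow>
            schur_multiplier_norm (loewner_matrix abs abs_deriv b)
              \<le> 3 + 2 * inverse golden_ratio * real (min r (n - r)))
       \<and> (r = 0 \<or> r = n \<longrightarrow>
            schur_multiplier_norm (loewner_matrix abs abs_deriv b) = 1)"
proof (intro conjI impI)
  let ?L = "loewner_matrix abs abs_deriv b"
  define P where "P = {i. b i > 0}"
  \<comment> \<open>Suprema of reals can be bounded or evaluated here only over a nonempty index
    set.\<close>
  have ne: "{A :: complex^'n^'n. A \<noteq> 0} \<noteq> {}"
  proof -
    have "(mat 1 :: complex^'n^'n) \<noteq> 0"
      by (simp add: vec_eq_iff mat_def)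
    then show ?thesis by blast
  qed
  have r: "r = card P"
    using assms by (simp add: P_def)
  have cardC: "card (- P) = n - r"
    using assms by (simp add: Compl_eq_Diff_UNIV card_Diff_subset r)
  show "schur_multiplier_norm ?L \<le> 3 + 2 * inverse golden_ratio * real (min r (n - r))"
  proof -
    obtain S where S: "S = P \<or> S = - P" "card S = min r (n - r)"
      by (metis r cardC min_def)
    let ?k = "real (card S)"
    \<comment> \<open>This amounts to \<open>golden_ratio \<le> 2\<close>.\<close>
    have "sqrt 5 \<le> 3"
      by (rule real_le_lsqrt) auto
    moreover have "0 < 1 + sqrt (5 :: real)"
      by (simp add: add_pos_nonneg)
    ultimately have "1 \<le> 2 * inverse golden_ratio"
      by (simp add: golden_ratio_def field_simps)
    then have "?k \<le> 2 * inverse golden_ratio * ?k"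
      by (simp add: mult_le_cancel_right1)
    \<comment> \<open>AM-GM for 1 and \<open>?k\<close> turns the square root into a linear
      bound.\<close>
    moreover have "2 * sqrt ?k \<le> 1 + ?k"
      using arith_geo_mean_sqrt[of 1 ?k] by simp
    ultimately have k: "1 + 2 * sqrt ?k \<le> 3 + 2 * inverse golden_ratio * ?k"
      by linarith
    have "schur_multiplier_norm ?L \<le> 1 + 2 * sqrt ?k"
      unfolding schur_multiplier_norm_def
    proof (rule cSUP_least[OF ne])
      fix A :: "complex^'n^'n" assume "A \<in> {A. A \<noteq> 0}"
      then have "0 < spectral_norm A" by (simp add: spectral_norm_pos)
      moreover have "spectral_norm (schur_product ?L A) \<le> (1 + 2 * sqrt ?k) * spectral_norm A"
        by (rule spectral_norm_schur_product_block_sign_le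
              [OF norm_loewner_matrix_abs_nth_le _ _ S(1)])
          (auto simp: P_def loewner_matrix_abs_nth)
      ultimately show "spectral_norm (schur_product ?L A) / spectral_norm A \<le> 1 + 2 * sqrt ?k"
        by (simp add: pos_divide_le_eq)
    qed
    with k S(2) show ?thesis by simp
  qed
  show "schur_multiplier_norm ?L = 1" if "r = 0 \<or> r = n"
  proof -
    from that have "P = {} \<or> P = UNIV"
      using assms(3) r by (metis card_eq_0_iff card_subset_eq finite subset_UNIV)
    \<comment> \<open>With a single sign block, all entries of \<open>?L\<close> are -1 or all are
      1, so every quotient in the supremum is 1.\<close>
    then have "schur_product ?L A = - A \<or> schur_product ?L A = A" for A :: "complex^'n^'n"
      by (auto simp: P_def schur_product_def loewner_matrix_abs_nth vec_eq_iff
          set_eq_iff linorder_not_less[symmetric])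
    then have "spectral_norm (schur_product ?L A) = spectral_norm A" for A :: "complex^'n^'n"
      by (metis spectral_norm_minus)
    moreover have "spectral_norm A \<noteq> 0" if "A \<noteq> 0" for A :: "complex^'n^'n"
      using spectral_norm_pos[OF that] by simp
    ultimately have "schur_multiplier_norm ?L = (SUP A \<in> {A :: complex^'n^'n. A \<noteq> 0}. 1)"
      unfolding schur_multiplier_norm_def
      by (intro SUP_cong) auto
    then show ?thesis using ne by simp
  qed
qed

end
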